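(* Let $n\ge 1$, let $f^{1},\dots,f^{n}$ be smooth real-valued functions of $x=(x^{1},\dots,x^{n})$, and consider the first order autonomous system $\frac{dx^{i}}{dt}=f^{i}(x^{1},\dots,x^{n})$, $i=1,\dots,n$. Let $P=(P^{i}_{j})_{i,j=1,\dots,n}$ be the curvature deviation tensor associated to this system, a function of $(x,y)=(x^1,\dots,x^n,y^1,\dots,y^n)$. Then $$P=\frac{1}{2}\begin{pmatrix}(H_{f^{1}}\cdot y)^{t}\\ \vdots\\ (H_{f^{n}}\cdot y)^{t}\end{pmatrix}+\frac{1}{4}J^{2}(f^{1},\dots,f^{n}),$$ that is, $P^{i}_{j}=\frac12\sum_{k=1}^{n}\frac{\partial^{2}f^{i}}{\partial x^{j}\partial x^{k}}\,y^{k}+\frac14\sum_{l=1}^{n}\frac{\partial f^{i}}{\partial x^{l}}\frac{\partial f^{l}}{\partial x^{j}}$ for all $i,j=1,\dots,n$. Here $y=(y^{1},\dots,y^{n})^{t}$, $H_{f^{k}}=\left(\frac{\partial^{2}f^{k}}{\partial x^{i}\partial x^{j}}\right)_{i,j=1,\dots,n}$ is the Hessian matrix of $f^{k}$, and $J(f^{1},\dots,f^{n})=\left(\frac{\partial f^{i}}{\partial x^{j}}\right)_{i,j=1,\dots,n}$ is the Jacobian matrix.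
   Context: For a second order system $\frac{d^{2}x^{i}}{dt^{2}}+2G^{i}(x,y,t)=0$, $i=1,\dots,n$, with $y^{i}=\frac{dx^{i}}{dt}$ and $G^i$ smooth functions of the independent coordinates $(x,y,t)$, define the nonlinear connection $N^{i}_{j}=\frac{\partial G^{i}}{\partial y^{j}}$, the Berwald connection $G^{i}_{jl}=\frac{\partial N^{i}_{j}}{\partial y^{l}}$, and the curvature deviation tensor (second KCC invariant; summation over the repeated index $l$ from $1$ to $n$) $$P^{i}_{j}=-2\frac{\partial G^{i}}{\partial x^{j}}-2G^{l}G^{i}_{jl}+y^{l}\frac{\partial N^{i}_{j}}{\partial x^{l}}+N^{i}_{l}N^{l}_{j}+\frac{\partial N^{i}_{j}}{\partial t}.$$ The curvature deviation tensor associated to a first order system $\frac{dx^{i}}{dt}=f^{i}(x)$ is the tensor $P^{i}_{j}$ of the second order system obtained by differentiating the first order system once with respect to $t$, namely $\frac{d^{2}x^{i}}{dt^{2}}-\sum_{k=1}^{n}\frac{\partial f^{i}}{\partial x^{k}}(x)\,y^{k}=0$, i.e. $G^{i}(x,y)=-\frac12\sum_{k=1}^{n}\frac{\partial f^{i}}{\partial x^{k}}(x)\,y^{k}$. *)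

theory Defs
  imports "HOL-Analysis.Analysis"
begin

definition partial_deriv :: "'n::finite \<Rightarrow> (real ^ 'n \<Rightarrow> real) \<Rightarrow> real ^ 'n \<Rightarrow> real" where
  "partial_deriv j g x = deriv (\<lambda>s. g (x + s *\<^sub>R axis j 1)) 0"

fun iterated_partial :: "'n::finite list \<Rightarrow> (real ^ 'n \<Rightarrow> real) \<Rightarrow> real ^ 'n \<Rightarrow> real" where
  "iterated_partial [] g = g"
| "iterated_partial (j # js) g = partial_deriv j (iterated_partial js g)"

text \<open>Smoothness on an open set: partial derivatives of all orders exist and are continuous.
  Existence has to be demanded separately, because \<^const>\<open>deriv\<close> is a total function.\<close>

definition smooth_fun_on :: "(real ^ 'n::finite) set \<Rightarrow> (real ^ 'n \<Rightarrow> real) \<Rightarrow> bool" where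
  "smooth_fun_on U g \<longleftrightarrow>
     (\<forall>js. continuous_on U (iterated_partial js g) \<and>
        (\<forall>x\<in>U. \<forall>j. (\<lambda>s. iterated_partial js g (x + s *\<^sub>R axis j 1)) differentiable (at 0)))"

definition jacobian_matrix :: "('n::finite \<Rightarrow> real ^ 'n \<Rightarrow> real) \<Rightarrow> real ^ 'n \<Rightarrow> real ^ 'n ^ 'n" where
  "jacobian_matrix f x = (\<chi> i j. partial_deriv j (f i) x)"

definition hessian_matrix :: "(real ^ 'n::finite \<Rightarrow> real) \<Rightarrow> real ^ 'n \<Rightarrow> real ^ 'n ^ 'n" where
  "hessian_matrix g x = (\<chi> i j. partial_deriv i (partial_deriv j g) x)"

text \<open>The coefficients \<open>G i x y t\<close> of a second order system
  \<open>x'' i + 2 * G i x y t = 0\<close> with \<open>y = x'\<close>; the variables \<open>x\<close>, \<open>y\<close>, \<open>t\<close> are independent.\<close>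

type_synonym 'n coefficients = "'n \<Rightarrow> real ^ 'n \<Rightarrow> real ^ 'n \<Rightarrow> real \<Rightarrow> real"

definition nonlinear_connection ::
    "'n::finite coefficients \<Rightarrow> 'n \<Rightarrow> 'n \<Rightarrow> real ^ 'n \<Rightarrow> real ^ 'n \<Rightarrow> real \<Rightarrow> real" where
  "nonlinear_connection G i j x y t = partial_deriv j (\<lambda>v. G i x v t) y"

definition berwald_connection ::
    "'n::finite coefficients \<Rightarrow> 'n \<Rightarrow> 'n \<Rightarrow> 'n \<Rightarrow> real ^ 'n \<Rightarrow> real ^ 'n \<Rightarrow> real \<Rightarrow> real" where
  "berwald_connection G i j l x y t = partial_deriv l (\<lambda>v. nonlinear_connection G i j x v t) y"

definition curvature_deviation ::
    "'n::finite coefficients \<Rightarrow> real ^ 'n \<Rightarrow> real ^ 'n \<Rightarrow> real \<Rightarrow> real ^ 'n ^ 'n" where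
  "curvature_deviation G x y t = (\<chi> i j.
     - 2 * partial_deriv j (\<lambda>u. G i u y t) x
     - 2 * (\<Sum>l\<in>UNIV. G l x y t * berwald_connection G i j l x y t)
     + (\<Sum>l\<in>UNIV. y $ l * partial_deriv l (\<lambda>u. nonlinear_connection G i j u y t) x)
     + (\<Sum>l\<in>UNIV. nonlinear_connection G i l x y t * nonlinear_connection G l j x y t)
     + deriv (\<lambda>s. nonlinear_connection G i j x y s) t)"

text \<open>Differentiating \<open>x' i = f i x\<close> once in \<open>t\<close> gives
  \<open>x'' i - (\<Sum>k. partial_deriv k (f i) x * y $ k) = 0\<close>.\<close>

definition prolonged_coefficients :: "('n::finite \<Rightarrow> real ^ 'n \<Rightarrow> real) \<Rightarrow> 'n coefficients" where
  "prolonged_coefficients f i x y t = - (1/2) * (\<Sum>k\<in>UNIV. partial_deriv k (f i) x * y $ k)"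

definition first_order_curvature_deviation ::
    "('n::finite \<Rightarrow> real ^ 'n \<Rightarrow> real) \<Rightarrow> real ^ 'n \<Rightarrow> real ^ 'n \<Rightarrow> real \<Rightarrow> real ^ 'n ^ 'n" where
  "first_order_curvature_deviation f = curvature_deviation (prolonged_coefficients f)"

end

theory Submission imports Defs begin

text \<open>The prolonged coefficients are linear in \<open>y\<close> and independent of \<open>t\<close>, so the Berwald connection
  and the \<open>t\<close>-derivative vanish, and \<open>N i j = - (1/2) * partial_deriv j (f i)\<close>. The terms
  \<open>- 2 * partial_deriv j (G i)\<close> and \<open>y l * partial_deriv l (N i j)\<close> then contribute
  second derivatives of \<open>f i\<close> in the two possible orders, with weights \<open>1\<close> and \<open>- 1/2\<close>; by
  Clairaut's theorem they add up to half the Hessian term.\<close>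

lemma partial_derivI:
  assumes "((\<lambda>s. g (x + s *\<^sub>R axis j 1)) has_real_derivative D) (at 0)"
  shows "partial_deriv j g x = D"
  using assms by (simp add: partial_deriv_def DERIV_imp_deriv)

text \<open>\<open>partial_deriv\<close> differentiates only at parameter 0. Shifting the parameter
  gives the derivative at every point of a line parallel to an axis, as the mean value theorem
  needs.\<close>

lemma has_real_derivative_partial_deriv:
  assumes "(\<lambda>s. g (w + s0 *\<^sub>R axis j 1 + s *\<^sub>R axis j 1)) differentiable (at (0::real))"
  shows "((\<lambda>s. g (w + s *\<^sub>R axis j 1)) has_real_derivative
           partial_deriv j g (w + s0 *\<^sub>R axis j 1)) (at s0)"
proof -
  have "((\<lambda>s. g (w + s0 *\<^sub>R axis j 1 + s *\<^sub>R axis j 1)) has_real_derivative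
           partial_deriv j g (w + s0 *\<^sub>R axis j 1)) (at 0)"
    using assms by (simp add: partial_deriv_def DERIV_deriv_iff_real_differentiable)
  then show ?thesis
    using DERIV_shift[of "\<lambda>s. g (w + s *\<^sub>R axis j 1)"
        "partial_deriv j g (w + s0 *\<^sub>R axis j 1)" 0 s0]
    by (simp add: algebra_simps scaleR_add_left)
qed

text \<open>The mean value theorem is applied twice, first along \<open>axis l 1\<close>, then along
  \<open>axis j 1\<close>. The second difference is symmetric in \<open>j\<close> and
  \<open>l\<close>, while the mixed derivative on the right is not; this asymmetry is what yields
  Clairaut's theorem.\<close>

lemma second_difference_mean_value:
  fixes g :: "real ^ 'n::finite \<Rightarrow> real"
  assumes g: "\<And>z. z \<in> ball x e \<Longrightarrow> (\<lambda>s. g (z + s *\<^sub>R axis l 1)) differentiable (at 0)"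
    and g': "\<And>z. z \<in> ball x e \<Longrightarrow>
      (\<lambda>s. partial_deriv l g (z + s *\<^sub>R axis j 1)) differentiable (at 0)"
    and h: "0 < h" "2 * h < e"
  obtains z where "z \<in> ball x e"
    and "g (x + h *\<^sub>R axis l 1 + h *\<^sub>R axis j 1) - g (x + h *\<^sub>R axis l 1)
         - g (x + h *\<^sub>R axis j 1) + g x = h\<^sup>2 * partial_deriv j (partial_deriv l g) z"
proof -
  \<comment> \<open>All points used below lie within \<open>a + b \<le> 2 * h < e\<close> of
    \<open>x\<close>. The bound comes from the triangle inequality, so it also covers
    \<open>j = l\<close>.\<close>
  have ball: "x + a *\<^sub>R axis l 1 + b *\<^sub>R axis j 1 \<in> ball x e"
    if "0 \<le> a" "a \<le> h" "0 \<le> b" "b \<le> h" for a b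
  proof -
    have "norm (a *\<^sub>R axis l (1::real) + b *\<^sub>R axis j 1) \<le> a + b"
      using norm_triangle_ineq[of "a *\<^sub>R axis l (1::real)" "b *\<^sub>R axis j 1"] that
      by (simp add: norm_axis_1)
    moreover have "dist x (x + a *\<^sub>R axis l 1 + b *\<^sub>R axis j 1) =
        norm (a *\<^sub>R axis l (1::real) + b *\<^sub>R axis j 1)"
      by (metis add.assoc add_diff_cancel_left' dist_commute dist_norm)
    ultimately show ?thesis
      using that h by simp
  qed
  \<comment> \<open>\<open>\<phi>\<close> is the increment of \<open>g\<close> in direction
    \<open>j\<close>, seen as a function of the displacement in direction \<open>l\<close>; the
    second difference is \<open>\<phi> h - \<phi> 0\<close>.\<close>
  define \<phi> where "\<phi> s = g (x + h *\<^sub>R axis j 1 + s *\<^sub>R axis l 1) - g (x + s *\<^sub>R axis l 1)" for s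
  have "(\<phi> has_real_derivative partial_deriv l g (x + h *\<^sub>R axis j 1 + s *\<^sub>R axis l 1)
          - partial_deriv l g (x + s *\<^sub>R axis l 1)) (at s)" if "0 \<le> s" "s \<le> h" for s
    unfolding \<phi>_def
    using ball[of s h] ball[of s 0] that h
    by (intro DERIV_diff has_real_derivative_partial_deriv g) (auto simp: add_ac)
  from MVT2[OF h(1) this] obtain \<xi> where \<xi>: "0 < \<xi>" "\<xi> < h"
    and \<phi>: "\<phi> h - \<phi> 0 = h * (partial_deriv l g (x + h *\<^sub>R axis j 1 + \<xi> *\<^sub>R axis l 1)
          - partial_deriv l g (x + \<xi> *\<^sub>R axis l 1))"
    by auto
  have "((\<lambda>s. partial_deriv l g (x + \<xi> *\<^sub>R axis l 1 + s *\<^sub>R axis j 1)) has_real_derivative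
          partial_deriv j (partial_deriv l g) (x + \<xi> *\<^sub>R axis l 1 + s *\<^sub>R axis j 1)) (at s)"
    if "0 \<le> s" "s \<le> h" for s
    using ball[of \<xi> s] that \<xi>
    by (intro has_real_derivative_partial_deriv g') auto
  from MVT2[OF h(1) this] obtain \<eta> where \<eta>: "0 < \<eta>" "\<eta> < h"
    and "partial_deriv l g (x + \<xi> *\<^sub>R axis l 1 + h *\<^sub>R axis j 1)
          - partial_deriv l g (x + \<xi> *\<^sub>R axis l 1)
         = h * partial_deriv j (partial_deriv l g) (x + \<xi> *\<^sub>R axis l 1 + \<eta> *\<^sub>R axis j 1)"
    by auto
  with \<phi> have "\<phi> h - \<phi> 0 =
      h\<^sup>2 * partial_deriv j (partial_deriv l g) (x + \<xi> *\<^sub>R axis l 1 + \<eta> *\<^sub>R axis j 1)"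
    by (simp add: power2_eq_square add_ac)
  with ball[of \<xi> \<eta>] \<xi> \<eta> show ?thesis
    by (intro that[of "x + \<xi> *\<^sub>R axis l 1 + \<eta> *\<^sub>R axis j 1"]) (auto simp: \<phi>_def add_ac)
qed

text \<open>For every small \<open>h\<close> both mixed derivatives, taken at suitable points near
  \<open>x\<close>, equal the same second difference divided by \<open>h\<^sup>2\<close>; continuity
  at \<open>x\<close> then forces equality. Differentiability is assumed along the axes only, as
  \<open>smooth_fun_on\<close> provides it.\<close>

theorem partial_deriv_commute:
  fixes g :: "real ^ 'n::finite \<Rightarrow> real"
  assumes U: "open U" "x \<in> U"
    and g: "\<And>z k. z \<in> U \<Longrightarrow> (\<lambda>s. g (z + s *\<^sub>R axis k 1)) differentiable (at 0)"
    and g': "\<And>z k m. z \<in> U \<Longrightarrow>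
      (\<lambda>s. partial_deriv k g (z + s *\<^sub>R axis m 1)) differentiable (at 0)"
    and cont: "\<And>k m. continuous_on U (partial_deriv k (partial_deriv m g))"
  shows "partial_deriv j (partial_deriv l g) x = partial_deriv l (partial_deriv j g) x"
proof (rule ccontr)
  let ?A = "partial_deriv j (partial_deriv l g)" and ?B = "partial_deriv l (partial_deriv j g)"
  assume "?A x \<noteq> ?B x"
  \<comment> \<open>Half the supposed gap: two errors below \<open>\<epsilon>\<close> cannot bridge
    it.\<close>
  define \<epsilon> where "\<epsilon> = dist (?A x) (?B x) / 2"
  have "\<epsilon> > 0"
    using \<open>?A x \<noteq> ?B x\<close> by (simp add: \<epsilon>_def)
  have "isCont ?A x" "isCont ?B x"
    using cont U by (auto simp: continuous_on_eq_continuous_at)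
  then obtain d1 d2 where d: "d1 > 0" "\<And>z. dist z x < d1 \<Longrightarrow> dist (?A z) (?A x) < \<epsilon>"
      "d2 > 0" "\<And>z. dist z x < d2 \<Longrightarrow> dist (?B z) (?B x) < \<epsilon>"
    using \<open>\<epsilon> > 0\<close> unfolding continuous_at_eps_delta dist_norm by metis
  obtain d3 where d3: "d3 > 0" "ball x d3 \<subseteq> U"
    using U by (meson open_contains_ball)
  define e where "e = min d1 (min d2 d3)"
  have e: "e > 0" "e \<le> d1" "e \<le> d2" "ball x e \<subseteq> U"
    using d(1,3) d3 subset_ball[of e d3 x] by (auto simp: e_def)
  define h where "h = e / 3"
  have h: "0 < h" "2 * h < e"
    using e by (auto simp: h_def)
  \<comment> \<open>Stated for arbitrary \<open>j\<close> and \<open>l\<close>, to be used in both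
    orders with the same \<open>h\<close>.\<close>
  have mean_value: "\<exists>z\<in>ball x e. g (x + h *\<^sub>R axis l 1 + h *\<^sub>R axis j 1) - g (x + h *\<^sub>R axis l 1)
         - g (x + h *\<^sub>R axis j 1) + g x = h\<^sup>2 * partial_deriv j (partial_deriv l g) z" for j l
    by (rule second_difference_mean_value[OF g[OF subsetD[OF e(4)]] g'[OF subsetD[OF e(4)]] h]) auto
  obtain z where z: "z \<in> ball x e"
      "g (x + h *\<^sub>R axis l 1 + h *\<^sub>R axis j 1) - g (x + h *\<^sub>R axis l 1)
         - g (x + h *\<^sub>R axis j 1) + g x = h\<^sup>2 * ?A z"
    using mean_value by blast
  obtain w where w: "w \<in> ball x e"
      "g (x + h *\<^sub>R axis j 1 + h *\<^sub>R axis l 1) - g (x + h *\<^sub>R axis j 1)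
         - g (x + h *\<^sub>R axis l 1) + g x = h\<^sup>2 * ?B w"
    using mean_value by blast
  have "h\<^sup>2 * ?A z = h\<^sup>2 * ?B w"
    unfolding z(2)[symmetric] w(2)[symmetric] by (simp add: algebra_simps)
  then have "?A z = ?B w"
    using h by simp
  moreover have "dist (?A z) (?A x) < \<epsilon>" "dist (?B w) (?B x) < \<epsilon>"
    using d(2)[of z] d(4)[of w] z(1) w(1) e(2,3) by (simp_all add: dist_commute)
  ultimately show False
    \<comment> \<open>The common value \<open>?A z = ?B w\<close> would lie within half the gap of
      both \<open>?A x\<close> and \<open>?B x\<close>.\<close>
    using dist_triangle_half_r[of "?B w" "?A x" "dist (?A x) (?B x)" "?B x"]
    by (simp add: \<epsilon>_def)
qed

lemma smooth_fun_on_differentiable: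
  assumes "smooth_fun_on U g" "x \<in> U"
  shows "(\<lambda>s. iterated_partial js g (x + s *\<^sub>R axis j 1)) differentiable (at 0)"
  using assms by (auto simp: smooth_fun_on_def)

lemma smooth_fun_on_partial_deriv_commute:
  assumes "open U" "smooth_fun_on U g" "x \<in> U"
  shows "partial_deriv j (partial_deriv l g) x = partial_deriv l (partial_deriv j g) x"
proof (rule partial_deriv_commute[OF assms(1,3)])
  fix z k m assume "z \<in> U"
  then show "(\<lambda>s. g (z + s *\<^sub>R axis k 1)) differentiable (at 0)"
    and "(\<lambda>s. partial_deriv k g (z + s *\<^sub>R axis m 1)) differentiable (at 0)"
    using smooth_fun_on_differentiable[OF assms(2), of z "[]"]
      smooth_fun_on_differentiable[OF assms(2), of z "[k]"] by auto
next
  fix k m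
  have "continuous_on U (iterated_partial [k, m] g)"
    using assms(2) unfolding smooth_fun_on_def by blast
  then show "continuous_on U (partial_deriv k (partial_deriv m g))"
    by simp
qed

lemma smooth_fun_on_has_second_partial:
  assumes "smooth_fun_on U g" "x \<in> U"
  shows "((\<lambda>s. partial_deriv k g (x + s *\<^sub>R axis j 1)) has_real_derivative
           partial_deriv j (partial_deriv k g) x) (at 0)"
  using has_real_derivative_partial_deriv[of "partial_deriv k g" x 0 j]
    smooth_fun_on_differentiable[OF assms, of "[k]" j] by simp

text \<open>The coefficients are linear in \<open>y\<close>, so differentiating in
  \<open>y $ j\<close> extracts the factor of \<open>y $ j\<close>. The result depends on neither
  \<open>y\<close> nor \<open>t\<close>.\<close>

lemma nonlinear_connection_prolonged:
  "nonlinear_connection (prolonged_coefficients f) i j x y t = - (1/2) * partial_deriv j (f i) x"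
proof -
  have "((\<lambda>s. - (1/2) * (\<Sum>k\<in>UNIV. partial_deriv k (f i) x * (y $ k + s * axis j 1 $ k)))
      has_real_derivative - (1/2) * (\<Sum>k\<in>UNIV. partial_deriv k (f i) x * axis j 1 $ k)) (at 0)"
    by (auto intro!: derivative_eq_intros simp: mult.commute)
  also have "(\<Sum>k\<in>UNIV. partial_deriv k (f i) x * axis j 1 $ k) = partial_deriv j (f i) x"
    by (simp add: axis_def if_distrib[of "(*) _"] cong: if_cong)
  finally show ?thesis
    by (auto simp: nonlinear_connection_def prolonged_coefficients_def intro!: partial_derivI)
qed

lemma berwald_connection_prolonged:
  "berwald_connection (prolonged_coefficients f) i j l x y t = 0"
  by (simp add: berwald_connection_def nonlinear_connection_prolonged partial_deriv_def)

lemma partial_deriv_prolonged: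
  assumes "smooth_fun_on U (f i)" "x \<in> U"
  shows "partial_deriv j (\<lambda>u. prolonged_coefficients f i u y t) x =
    - (1/2) * (\<Sum>k\<in>UNIV. partial_deriv j (partial_deriv k (f i)) x * y $ k)"
  unfolding prolonged_coefficients_def
  by (intro partial_derivI DERIV_cmult DERIV_sum DERIV_cmult_right
      smooth_fun_on_has_second_partial[OF assms])

lemma partial_deriv_nonlinear_connection_prolonged:
  assumes "smooth_fun_on U (f i)" "x \<in> U"
  shows "partial_deriv l (\<lambda>u. nonlinear_connection (prolonged_coefficients f) i j u y t) x =
    - (1/2) * partial_deriv l (partial_deriv j (f i)) x"
  unfolding nonlinear_connection_prolonged
  by (intro partial_derivI DERIV_cmult smooth_fun_on_has_second_partial[OF assms])

lemma first_order_curvature_deviation_nth: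
  assumes "open U" "\<And>i. smooth_fun_on U (f i)" "x \<in> U"
  shows "first_order_curvature_deviation f x y t $ i $ j =
           1/2 * (\<Sum>k\<in>UNIV. partial_deriv j (partial_deriv k (f i)) x * y $ k)
           + 1/4 * (\<Sum>l\<in>UNIV. partial_deriv l (f i) x * partial_deriv j (f l) x)"
proof -
  let ?N = "nonlinear_connection (prolonged_coefficients f)"
  let ?H = "\<Sum>k\<in>UNIV. partial_deriv j (partial_deriv k (f i)) x * y $ k"
  \<comment> \<open>The only use of Clairaut's theorem: here the derivative in direction
    \<open>l\<close>, paired with \<open>y $ l\<close>, is the outer one, whereas in
    \<open>?H\<close> it is the inner one.\<close>
  have "(\<Sum>l\<in>UNIV. y $ l * partial_deriv l (\<lambda>u. ?N i j u y t) x) = - (1/2) * ?H"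
    unfolding partial_deriv_nonlinear_connection_prolonged[OF assms(2,3)] sum_distrib_left
    using smooth_fun_on_partial_deriv_commute[OF assms]
    by (intro sum.cong refl) (metis mult.assoc mult.commute)
  moreover have "(\<Sum>l\<in>UNIV. ?N i l x y t * ?N l j x y t) =
      1/4 * (\<Sum>l\<in>UNIV. partial_deriv l (f i) x * partial_deriv j (f l) x)"
    by (simp add: nonlinear_connection_prolonged sum_distrib_left)
  moreover have "deriv (\<lambda>s. ?N i j x y s) t = 0"
    by (simp add: nonlinear_connection_prolonged)
  ultimately show ?thesis
    by (simp add: first_order_curvature_deviation_def curvature_deviation_def
        berwald_connection_prolonged partial_deriv_prolonged[where f=f, OF assms(2,3)])
qed

theorem proposition1:
  fixes f :: "'n::finite \<Rightarrow> real ^ 'n \<Rightarrow> real"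
    and U :: "(real ^ 'n) set"
    and x y :: "real ^ 'n"
    and t :: real
  assumes "open U"
    and "\<And>i. smooth_fun_on U (f i)"
    and "x \<in> U"
  shows "first_order_curvature_deviation f x y t =
           (1/2) *\<^sub>R (\<chi> i. hessian_matrix (f i) x *v y)
           + (1/4) *\<^sub>R (jacobian_matrix f x ** jacobian_matrix f x)
       \<and> (\<forall>i j. first_order_curvature_deviation f x y t $ i $ j =
           1/2 * (\<Sum>k\<in>UNIV. partial_deriv j (partial_deriv k (f i)) x * y $ k)
           + 1/4 * (\<Sum>l\<in>UNIV. partial_deriv l (f i) x * partial_deriv j (f l) x))"
  \<comment> \<open>Row \<open>i\<close> of the first matrix is the vector
    \<open>hessian_matrix (f i) x *v y\<close>, so its entry \<open>j\<close> comes from row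
    \<open>j\<close> of that Hessian.\<close>
  using first_order_curvature_deviation_nth[OF assms]
  by (simp add: vec_eq_iff hessian_matrix_def jacobian_matrix_def matrix_vector_mult_def
      matrix_matrix_mult_def)

end
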